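(* There exist a function $\epsilon\colon\mathbb N\to(0,1)$, a family of monotone Boolean functions $\{f_n\colon\{0,1\}^n\to\{0,1\}\}_{n\in\mathbb N}$ and a family of distributions $\{\mu_n\}_{n\in\mathbb N}$ with $\mu_n$ supported on $f_n^{-1}(1)$ such that: (1) there are CNF formulas $\phi_n$ of size at most $n^{O(1)}$ with $\phi_n^{-1}(1)\subseteq f_n^{-1}(1)$ and $\Pr_{x\sim\mu_n}[\phi_n(x)=1]\ge\epsilon(n)$; whereas (2) any monotone CNF formulas $\phi_n^+$ with $(\phi_n^+)^{-1}(1)\subseteq f_n^{-1}(1)$ and $\Pr_{x\sim\mu_n}[\phi_n^+(x)=1]\ge\epsilon(n)$ must have size $2^{n^{\Omega(1)}}$.
   Context: A CNF formula is an AND of clauses (ORs of literals); it is monotone if no literal is negated; its size is its number of clauses. A Boolean function is monotone if $x\le y$ coordinatewise implies $f(x)\le f(y)$. *)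

theory Defs
  imports "HOL-Probability.Probability"
begin

text \<open>Points of the \<open>n\<close>-cube are truth assignments to the variables \<open>0, \<dots>, n - 1\<close>, extended
  by the fixed value \<^term>\<open>undefined\<close>. All points of one cube agree outside \<^term>\<open>{..<n}\<close>,
  so the library's pointwise order on functions is the coordinatewise order on the cube and
  \<^const>\<open>mono_on\<close> is monotonicity of Boolean functions.\<close>

definition cube :: "nat \<Rightarrow> (nat \<Rightarrow> bool) set" where
  "cube n = {..<n} \<rightarrow>\<^sub>E UNIV"

definition ones :: "nat \<Rightarrow> ((nat \<Rightarrow> bool) \<Rightarrow> bool) \<Rightarrow> (nat \<Rightarrow> bool) set" where
  "ones n f = {x \<in> cube n. f x}"

datatype literal = Pos (var: nat) | Neg (var: nat)

fun lit_true :: "(nat \<Rightarrow> bool) \<Rightarrow> literal \<Rightarrow> bool" where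
  "lit_true x (Pos i) = x i"
| "lit_true x (Neg i) = (\<not> x i)"

text \<open>The empty clause is false and the empty formula is true.\<close>

type_synonym clause = "literal list"
type_synonym cnf = "clause list"

definition cnf_eval :: "cnf \<Rightarrow> (nat \<Rightarrow> bool) \<Rightarrow> bool" where
  "cnf_eval \<phi> x \<longleftrightarrow> (\<forall>C \<in> set \<phi>. \<exists>l \<in> set C. lit_true x l)"

definition cnf_over :: "nat \<Rightarrow> cnf \<Rightarrow> bool" where
  "cnf_over n \<phi> \<longleftrightarrow> (\<forall>C \<in> set \<phi>. \<forall>l \<in> set C. var l < n)"

definition monotone_cnf :: "cnf \<Rightarrow> bool" where
  "monotone_cnf \<phi> \<longleftrightarrow> (\<forall>C \<in> set \<phi>. \<forall>l \<in> set C. \<exists>i. l = Pos i)"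

definition cnf_size :: "cnf \<Rightarrow> nat" where
  "cnf_size \<phi> = length \<phi>"

text \<open>Soundness of \<open>\<phi>\<close> for \<open>f\<close>, together with acceptance probability at least \<open>e\<close> under \<open>\<mu>\<close>.\<close>

definition approximates ::
  "nat \<Rightarrow> real \<Rightarrow> ((nat \<Rightarrow> bool) \<Rightarrow> bool) \<Rightarrow> (nat \<Rightarrow> bool) pmf \<Rightarrow> cnf \<Rightarrow> bool" where
  "approximates n e f \<mu> \<phi> \<longleftrightarrow>
     cnf_over n \<phi> \<and> ones n (cnf_eval \<phi>) \<subseteq> ones n f \<and>
     measure_pmf.prob \<mu> {x. cnf_eval \<phi> x} \<ge> e"

end

theory Submission imports Defs begin

text \<open>Write \<open>m = n div 2\<close> and let \<open>f\<close> be the disjunction of the \<open>m\<close> disjoint terms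
  \<open>x\<^sub>i \<and> x\<^sub>m\<^sub>+\<^sub>i\<close>, with \<open>\<mu>\<close> uniform on its \<open>m\<close> minterms and \<open>\<epsilon> = 1/2\<close>. The non-monotone formula
  \<open>(\<Or>i. x\<^sub>i) \<and> (\<And>i. \<not> x\<^sub>i \<or> x\<^sub>m\<^sub>+\<^sub>i)\<close> implies \<open>f\<close> and accepts every minterm.
  A point containing exactly one variable of each pair is rejected by \<open>f\<close>, so a sound formula has
  a clause rejecting it. A monotone clause rejecting two such points that differ on the pair \<open>i\<close>
  contains neither variable of that pair, so it also rejects the \<open>i\<close>-th minterm. Hence a sound monotone
  formula accepting the minterms with index in \<open>I\<close> needs \<open>2 ^ card I\<close> clauses.\<close>

text \<open>For \<open>n < 2\<close> there are no pairs; the disjunct \<open>n < 2\<close> keeps the function satisfiable, as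
  \<open>\<mu>\<close> needs a nonempty support.\<close>

definition pair_fun :: "nat \<Rightarrow> (nat \<Rightarrow> bool) \<Rightarrow> bool" where
  "pair_fun n x \<longleftrightarrow> n < 2 \<or> (\<exists>i < n div 2. x i \<and> x (n div 2 + i))"

definition pair_point :: "nat \<Rightarrow> nat \<Rightarrow> nat \<Rightarrow> bool" where
  "pair_point n i = restrict (\<lambda>j. j = i \<or> j = n div 2 + i) {..<n}"

text \<open>\<open>J\<close> encodes a choice of one variable from each pair, the first for indices
  in \<open>J\<close>, so that sets of indices count the choices.\<close>

definition transversal :: "nat \<Rightarrow> nat set \<Rightarrow> nat \<Rightarrow> bool" where
  "transversal n J = restrict (\<lambda>j. if j < n div 2 then j \<in> J else j - n div 2 \<notin> J) {..<n}"

definition pair_cnf :: "nat \<Rightarrow> cnf" where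
  "pair_cnf n = (if n < 2 then [] else
     map Pos [0..<n div 2] # map (\<lambda>i. [Neg i, Pos (n div 2 + i)]) [0..<n div 2])"

text \<open>For \<open>n < 2\<close> the index set is empty and carries no uniform distribution; a
  point mass stands in.\<close>

definition minterm_pmf :: "nat \<Rightarrow> (nat \<Rightarrow> bool) pmf" where
  "minterm_pmf n = (if n < 2 then return_pmf (restrict (\<lambda>_. True) {..<n})
     else map_pmf (pair_point n) (pmf_of_set {..<n div 2}))"

lemma mono_on_pair_fun: "mono_on A (pair_fun n)"
  unfolding mono_on_def pair_fun_def le_fun_def le_bool_def by blast

lemma pair_point_in_ones:
  assumes "i < n div 2"
  shows "pair_point n i \<in> ones n (pair_fun n)"
proof -
  have "i < n" "n div 2 + i < n" using assms by linarith+
  then have "pair_fun n (pair_point n i)"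
    unfolding pair_fun_def pair_point_def using assms by (intro disjI2 exI[of _ i]) simp
  moreover have "pair_point n i \<in> cube n"
    by (simp add: cube_def pair_point_def)
  ultimately show ?thesis by (simp add: ones_def)
qed

lemma transversal_in_cube: "transversal n J \<in> cube n"
  by (auto simp: cube_def transversal_def)

lemma not_pair_fun_transversal:
  assumes "n \<ge> 2"
  shows "\<not> pair_fun n (transversal n J)"
  using assms by (auto simp: pair_fun_def transversal_def)

lemma set_minterm_pmf:
  assumes "n \<ge> 2"
  shows "set_pmf (minterm_pmf n) = pair_point n ` {..<n div 2}"
proof -
  have "{..<n div 2} \<noteq> {}" using assms by (simp add: lessThan_empty_iff)
  then show ?thesis using assms by (simp add: minterm_pmf_def)
qed

lemma prob_minterm_pmf:
  assumes "n \<ge> 2"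
  shows "measure_pmf.prob (minterm_pmf n) {x. P x} =
    card {i. i < n div 2 \<and> P (pair_point n i)} / real (n div 2)"
proof -
  have "{..<n div 2} \<noteq> {}" using assms by (simp add: lessThan_empty_iff)
  moreover have "{..<n div 2} \<inter> pair_point n -` {x. P x} = {i. i < n div 2 \<and> P (pair_point n i)}"
    by auto
  ultimately show ?thesis
    using assms by (simp add: minterm_pmf_def measure_pmf_of_set)
qed

lemma set_minterm_pmf_subset: "set_pmf (minterm_pmf n) \<subseteq> ones n (pair_fun n)"
proof (cases "n < 2")
  case True
  then show ?thesis by (auto simp: minterm_pmf_def ones_def cube_def pair_fun_def)
next
  case False
  then show ?thesis using pair_point_in_ones by (auto simp: set_minterm_pmf)
qed

lemma pair_cnf_sound:
  assumes "cnf_eval (pair_cnf n) x"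
  shows "pair_fun n x"
proof (cases "n < 2")
  case False
  then have "\<exists>i < n div 2. x i" "\<forall>i < n div 2. x i \<longrightarrow> x (n div 2 + i)"
    using assms by (auto simp: cnf_eval_def pair_cnf_def)
  then show ?thesis by (auto simp: pair_fun_def)
qed (simp add: pair_fun_def)

lemma pair_cnf_over: "cnf_over n (pair_cnf n)"
  by (auto simp: cnf_over_def pair_cnf_def)

lemma pair_cnf_pair_point:
  assumes "i < n div 2"
  shows "cnf_eval (pair_cnf n) (pair_point n i)"
proof -
  have "\<not> n < 2" "i < n" "n div 2 + i < n" using assms by linarith+
  then show ?thesis
    using assms by (auto simp: cnf_eval_def pair_cnf_def pair_point_def)
qed

text \<open>The whole support is accepted, so the acceptance probability is 1 and meets every
  threshold \<open>e \<le> 1\<close>.\<close>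

lemma approximates_pair_cnf:
  assumes "e \<le> 1"
  shows "approximates n e (pair_fun n) (minterm_pmf n) (pair_cnf n)"
proof -
  have "x \<in> set_pmf (minterm_pmf n) \<Longrightarrow> cnf_eval (pair_cnf n) x" for x
  proof (cases "n < 2")
    case True
    then show ?thesis by (simp add: pair_cnf_def cnf_eval_def)
  next
    case False
    then show "x \<in> set_pmf (minterm_pmf n) \<Longrightarrow> ?thesis"
      using pair_cnf_pair_point by (auto simp: set_minterm_pmf)
  qed
  then have "measure_pmf.prob (minterm_pmf n) {x. cnf_eval (pair_cnf n) x} = 1"
    by (simp add: measure_pmf.prob_eq_1 AE_measure_pmf_iff)
  then show ?thesis
    using assms pair_cnf_over pair_cnf_sound by (auto simp: approximates_def ones_def)
qed

lemma monotone_cnf_size_ge: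
  assumes n: "n \<ge> 2" and mono: "monotone_cnf \<psi>" and over: "cnf_over n \<psi>"
    and sound: "ones n (cnf_eval \<psi>) \<subseteq> ones n (pair_fun n)"
  shows "2 ^ card {i. i < n div 2 \<and> cnf_eval \<psi> (pair_point n i)} \<le> cnf_size \<psi>"
proof -
  define I where "I = {i. i < n div 2 \<and> cnf_eval \<psi> (pair_point n i)}"
  have "\<exists>C \<in> set \<psi>. \<forall>l \<in> set C. \<not> lit_true (transversal n J) l" for J
  proof -
    have "transversal n J \<notin> ones n (cnf_eval \<psi>)"
      using sound not_pair_fun_transversal[OF n] by (auto simp: ones_def)
    then show ?thesis using transversal_in_cube by (auto simp: ones_def cnf_eval_def)
  qed
  then obtain g where g: "\<And>J. g J \<in> set \<psi>"
    and false: "\<And>J l. l \<in> set (g J) \<Longrightarrow> \<not> lit_true (transversal n J) l"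
    by metis
  \<comment> \<open>Acceptance of minterm \<open>i\<close> puts a literal true there into the shared
    clause; monotonicity makes it one of the two variables of pair \<open>i\<close>, and both
    transversals falsify it.\<close>
  have same: "i \<in> J \<longleftrightarrow> i \<in> K" if "g J = g K" "i \<in> I" for i J K
  proof -
    obtain l where l: "l \<in> set (g J)" "lit_true (pair_point n i) l"
      using \<open>i \<in> I\<close> g[of J] by (auto simp: I_def cnf_eval_def)
    obtain j where j: "l = Pos j" "j < n"
      using mono over g[of J] l(1) by (fastforce simp: monotone_cnf_def cnf_over_def)
    have "\<not> transversal n J j" "\<not> transversal n K j"
      using false[of l J] false[of l K] l(1) j(1) that(1) by auto
    moreover have "j = i \<or> j = n div 2 + i" "i < n div 2"
      using l(2) j \<open>i \<in> I\<close> by (auto simp: pair_point_def I_def)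
    \<comment> \<open>A false first variable puts \<open>i\<close> outside both sets, a false second
      one puts it inside both.\<close>
    ultimately show ?thesis using j(2) by (auto simp: transversal_def)
  qed
  have "inj_on g (Pow I)"
    by (rule inj_onI) (use same in blast)
  moreover have "g ` Pow I \<subseteq> set \<psi>" using g by blast
  ultimately have "card (Pow I) \<le> card (set \<psi>)"
    by (intro card_inj_on_le) auto
  also have "\<dots> \<le> length \<psi>" by (rule card_length)
  finally show ?thesis by (simp add: I_def card_Pow cnf_size_def)
qed

text \<open>Under the uniform distribution, acceptance probability \<open>e\<close> means at least
  \<open>e * real (n div 2)\<close> accepted minterms.\<close>

lemma monotone_cnf_size_ge_powr:
  assumes n: "n \<ge> 2" and mono: "monotone_cnf \<psi>"
    and approx: "approximates n e (pair_fun n) (minterm_pmf n) \<psi>"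
  shows "2 powr (e * real (n div 2)) \<le> real (cnf_size \<psi>)"
proof -
  define I where "I = {i. i < n div 2 \<and> cnf_eval \<psi> (pair_point n i)}"
  have "e \<le> card I / real (n div 2)"
    using approx unfolding approximates_def I_def prob_minterm_pmf[OF n] by simp
  moreover have "0 < real (n div 2)" using n by simp
  ultimately have "e * real (n div 2) \<le> card I" by (simp add: pos_le_divide_eq)
  then have "2 powr (e * real (n div 2)) \<le> 2 powr real (card I)" by simp
  also have "\<dots> = real (2 ^ card I)" by (simp add: powr_realpow)
  also have "\<dots> \<le> real (cnf_size \<psi>)"
    using monotone_cnf_size_ge[OF n mono] approx
    unfolding approximates_def I_def of_nat_le_iff by blast
  finally show ?thesis .
qed

theorem theorem4p1:
  "\<exists>(\<epsilon> :: nat \<Rightarrow> real) (f :: nat \<Rightarrow> (nat \<Rightarrow> bool) \<Rightarrow> bool) (\<mu> :: nat \<Rightarrow> (nat \<Rightarrow> bool) pmf).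
     (\<forall>n. 0 < \<epsilon> n \<and> \<epsilon> n < 1) \<and>
     (\<forall>n. mono_on (cube n) (f n)) \<and>
     (\<forall>n. set_pmf (\<mu> n) \<subseteq> ones n (f n)) \<and>
     (\<exists>\<phi> :: nat \<Rightarrow> cnf.
        (\<forall>n. approximates n (\<epsilon> n) (f n) (\<mu> n) (\<phi> n)) \<and>
        (\<exists>k :: nat. \<forall>\<^sub>F n in sequentially. cnf_size (\<phi> n) \<le> n ^ k)) \<and>
     (\<exists>c :: real. c > 0 \<and>
        (\<forall>\<^sub>F n in sequentially. \<forall>\<psi> :: cnf.
           monotone_cnf \<psi> \<and> approximates n (\<epsilon> n) (f n) (\<mu> n) \<psi> \<longrightarrow>
           real (cnf_size \<psi>) \<ge> 2 powr (real n powr c)))"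
proof (rule exI[of _ "\<lambda>_. 1 / 2"], rule exI[of _ pair_fun], rule exI[of _ minterm_pmf],
    intro conjI allI exI[of _ pair_cnf] exI[of _ "1 :: nat"] exI[of _ "1 / 2 :: real"])
  fix n :: nat
  show "0 < (1 / 2 :: real)" "(1 / 2 :: real) < 1" by simp_all
  show "mono_on (cube n) (pair_fun n)" by (rule mono_on_pair_fun)
  show "set_pmf (minterm_pmf n) \<subseteq> ones n (pair_fun n)" by (rule set_minterm_pmf_subset)
  show "approximates n (1 / 2) (pair_fun n) (minterm_pmf n) (pair_cnf n)"
    by (rule approximates_pair_cnf) simp
next
  \<comment> \<open>There are \<open>n div 2 + 1\<close> clauses, at most \<open>n\<close> once
    \<open>n \<ge> 2\<close>.\<close>
  show "\<forall>\<^sub>F n in sequentially. cnf_size (pair_cnf n) \<le> n ^ 1"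
    using eventually_ge_at_top[of 2]
    by eventually_elim (auto simp: cnf_size_def pair_cnf_def)
next
  show "(0 :: real) < 1 / 2" by simp
next
  \<comment> \<open>The right side bounds the exponent \<open>1 / 2 * real (n div 2)\<close> from
    below, allowing for odd \<open>n\<close>. From 25 on, \<open>sqrt n \<ge> 5\<close>, so
    \<open>n \<ge> 5 * sqrt n \<ge> 4 * sqrt n + 1\<close>.\<close>
  have "\<forall>\<^sub>F n in sequentially. real n powr (1 / 2) \<le> (real n - 1) / 4"
    using eventually_ge_at_top[of 25]
  proof eventually_elim
    case (elim n)
    have "5 \<le> sqrt (real n)" using elim by (intro real_le_rsqrt) simp
    then have "5 * sqrt (real n) \<le> sqrt (real n) * sqrt (real n)" by (intro mult_right_mono) auto
    then have "4 * sqrt (real n) + 1 \<le> real n" using \<open>5 \<le> sqrt (real n)\<close> by simp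
    then show ?case by (simp add: powr_half_sqrt)
  qed
  then show "\<forall>\<^sub>F n in sequentially. \<forall>\<psi>. monotone_cnf \<psi> \<and>
      approximates n (1 / 2) (pair_fun n) (minterm_pmf n) \<psi> \<longrightarrow>
      2 powr (real n powr (1 / 2)) \<le> real (cnf_size \<psi>)"
    using eventually_ge_at_top[of 2]
  proof eventually_elim
    case (elim n)
    have "n \<le> 2 * (n div 2) + 1" by linarith
    then have "real n \<le> real (2 * (n div 2) + 1)" by (rule of_nat_mono)
    then have "(real n - 1) / 4 \<le> 1 / 2 * real (n div 2)" by (simp only: of_nat_add of_nat_mult) simp
    then have "real n powr (1 / 2) \<le> 1 / 2 * real (n div 2)" using elim(1) by (rule order_trans[rotated])
    then have "2 powr (real n powr (1 / 2)) \<le> 2 powr (1 / 2 * real (n div 2))"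
      by (intro powr_mono) auto
    then show ?case using monotone_cnf_size_ge_powr[OF elim(2)] order_trans by blast
  qed
qed

end
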